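(* Let $k>3$ be a parameter known to all nodes. There is a distributed algorithm in the \textsc{Beeping} model that solves \textsc{SetCover} in time $O(k^3)$ with approximation ratio $O\left(\log^2(\Delta)\cdot \left(\Delta^{1/k}\right)^3\right)$.
   Context: \textsc{SetCover}: given a ground set $\mathcal{U}$ of elements and a family $\mathcal{S}$ of subsets of $\mathcal{U}$, find a minimum number of sets from $\mathcal{S}$ whose union is $\mathcal{U}$. The approximation ratio compares the size of the output cover with the size $|S_{OPT}|$ of an optimal cover. Problem/communication graph: $G=(V_{\mathcal{S}}\cup V_{\mathcal{U}},E)$, with one node per set and one node per element, and a bidirected edge $\{s,e\}$ whenever set $s$ contains element $e$. Nodes communicate only with their neighbors in $G$. $\Delta$ is the maximum degree of $G$ and is known to all nodes. Nodes do not know their exact degree and have no identifiers. \textsc{Beeping} model: time proceeds in synchronized slots, and all nodes wake up in the same slot. In each slot a node either beeps or listens, not both. A listening node receives a beep if and only if at least one of its neighbors beeps in that slot. It cannot tell which neighbors beeped or how many did. *)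

theory Defs
  imports "HOL-Probability.Probability"
begin

text \<open>An instance: set nodes VS, element nodes VU (disjoint, finite), and the
membership relation M (pair (s,e) in M iff set s contains element e).\<close>

definition wf_instance :: "'v set \<Rightarrow> 'v set \<Rightarrow> ('v \<times> 'v) set \<Rightarrow> bool" where
  "wf_instance VS VU M \<longleftrightarrow> finite VS \<and> finite VU \<and> VS \<inter> VU = {} \<and> M \<subseteq> VS \<times> VU"

definition adj :: "('v \<times> 'v) set \<Rightarrow> 'v \<Rightarrow> 'v \<Rightarrow> bool" where
  "adj M u v \<longleftrightarrow> (u, v) \<in> M \<or> (v, u) \<in> M"

definition degree :: "('v \<times> 'v) set \<Rightarrow> 'v \<Rightarrow> nat" where
  "degree M v = card {u. adj M u v}"

definition max_degree :: "'v set \<Rightarrow> 'v set \<Rightarrow> ('v \<times> 'v) set \<Rightarrow> nat" where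
  "max_degree VS VU M = Max (degree M ` (VS \<union> VU))"

definition is_cover :: "'v set \<Rightarrow> 'v set \<Rightarrow> ('v \<times> 'v) set \<Rightarrow> 'v set \<Rightarrow> bool" where
  "is_cover VS VU M C \<longleftrightarrow> C \<subseteq> VS \<and> (\<forall>e\<in>VU. \<exists>s\<in>C. (s, e) \<in> M)"

definition opt_cover :: "'v set \<Rightarrow> 'v set \<Rightarrow> ('v \<times> 'v) set \<Rightarrow> nat" where
  "opt_cover VS VU M = Min (card ` {C. is_cover VS VU M C})"

text \<open>A (randomized, anonymous, uniform) local algorithm with state type 's:
  \<^item> init r : initial state of a node with role r (True = set node, False = element node);
    nodes have no identifiers and do not know their degree;
  \<^item> step s : random choice made in a slot from state s: whether to beep, and the
    state update as a function of what is heard (a beeping node hears nothing);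
  \<^item> out s : whether a set node in state s puts itself into the cover.
All nodes wake up in the same slot; random choices of different nodes are independent.\<close>

definition heard :: "('v \<times> 'v) set \<Rightarrow> 'v set \<Rightarrow> ('v \<Rightarrow> bool \<times> (bool \<Rightarrow> 's)) \<Rightarrow> 'v \<Rightarrow> bool" where
  "heard M V ch v \<longleftrightarrow> \<not> fst (ch v) \<and> (\<exists>u\<in>V. adj M u v \<and> fst (ch u))"

definition beep_round ::
  "'v set \<Rightarrow> ('v \<times> 'v) set \<Rightarrow> ('s \<Rightarrow> (bool \<times> (bool \<Rightarrow> 's)) pmf) \<Rightarrow> ('v \<Rightarrow> 's) \<Rightarrow> ('v \<Rightarrow> 's) pmf" where
  "beep_round V M step c =
     map_pmf (\<lambda>ch v. if v \<in> V then snd (ch v) (heard M V ch v) else c v)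
       (Pi_pmf V undefined (\<lambda>v. step (c v)))"

primrec beep_exec ::
  "'v set \<Rightarrow> 'v set \<Rightarrow> ('v \<times> 'v) set \<Rightarrow> (bool \<Rightarrow> 's) \<Rightarrow> ('s \<Rightarrow> (bool \<times> (bool \<Rightarrow> 's)) pmf)
     \<Rightarrow> nat \<Rightarrow> ('v \<Rightarrow> 's) pmf" where
  "beep_exec VS VU M init step 0 = return_pmf (\<lambda>v. init (v \<in> VS))"
| "beep_exec VS VU M init step (Suc t) =
     bind_pmf (beep_exec VS VU M init step t) (beep_round (VS \<union> VU) M step)"

definition output_cover :: "'v set \<Rightarrow> ('s \<Rightarrow> bool) \<Rightarrow> ('v \<Rightarrow> 's) \<Rightarrow> 'v set" where
  "output_cover VS out c = {s \<in> VS. out (c s)}"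

end

theory Submission
  imports Defs
begin

text \<open>With \<open>q = \<Delta> powr (1 / K)\<close>, run phases \<open>i = 0..K\<close> of trials \<open>j = 0..K\<close> of two slots each. In the
  first slot, uncovered elements beep with probability \<open>b = q ^ i / \<Delta>\<close>, and a set stays active in the
  phase only if it hears a beep; in the second, active sets join the cover and beep with probability
  \<open>p = q ^ j / \<Delta>\<close>, which covers the elements hearing them.

  Cost: a set that passes the test is charged to a beeping element, so an uncovered element with \<open>a\<close>
  active sets pays \<open>b p a\<close>. Active sets only decrease within a phase, and
  \<open>a p (1 - p) ^ a \<le> 1 - (1 - p) ^ a\<close>, so the payment in the next trial is at most \<open>b q\<close> times
  the probability of being covered in this one. Hence a phase starting with \<open>U\<close> uncovered costs at
  most \<open>b (1 + q) |U|\<close> in expectation.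

  Progress: a set with \<open>r\<close> uncovered elements fails a test with probability \<open>(1 - b) ^ r\<close>, and
  \<open>r (1 - b) ^ r \<le> 1 / b\<close>; sets still active at the end join with \<open>p = 1\<close>. So after the phase every
  set, in particular every set of an optimal cover, has at most \<open>(K + 1) / b\<close> uncovered elements in
  expectation, and none after the last phase, where \<open>b = 1\<close>. Summing over the phases gives a cover of
  expected size at most \<open>(K + 1)\<^sup>2 q (1 + q)\<close> times the optimum.\<close>

section \<open>Expectations over finite supports\<close>

text \<open>Bernoulli bounds \<open>1 + n * p\<close> by \<open>(1 + p) ^ n\<close>, and
  \<open>(1 - p) * (1 + p) \<le> 1\<close>. Both the cost bound and the progress bound rest on
  this.\<close>

lemma mult_power_Bernoulli_le:
  fixes p :: real
  assumes "0 \<le> p" "p \<le> 1"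
  shows "(1 - p) ^ n * (1 + n * p) \<le> 1"
proof -
  have "1 + n * p \<le> (1 + p) ^ n"
    using Bernoulli_inequality[of p n] assms by (simp add: algebra_simps)
  hence "(1 - p) ^ n * (1 + n * p) \<le> (1 - p) ^ n * (1 + p) ^ n"
    using assms by (intro mult_left_mono) auto
  also have "\<dots> = (1 - p\<^sup>2) ^ n"
    by (simp add: power_mult_distrib[symmetric] algebra_simps power2_eq_square)
  also have "\<dots> \<le> 1"
    using assms by (intro power_le_one) (auto simp: power_le_one)
  finally show ?thesis .
qed

lemma mult_power_le_inverse:
  fixes b :: real
  assumes "0 < b" "b \<le> 1"
  shows "real n * (1 - b) ^ n \<le> 1 / b"
proof -
  have "0 \<le> (1 - b) ^ n" using assms by simp
  moreover have "(1 - b) ^ n + (1 - b) ^ n * (real n * b) \<le> 1"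
    using mult_power_Bernoulli_le[of b n] assms by (simp add: algebra_simps)
  ultimately have "(1 - b) ^ n * (real n * b) \<le> 1" by linarith
  thus ?thesis using assms by (simp add: field_simps)
qed

lemma expectation_mono_finite:
  fixes f g :: "'a \<Rightarrow> real"
  assumes "finite (set_pmf P)" "\<And>x. x \<in> set_pmf P \<Longrightarrow> f x \<le> g x"
  shows "measure_pmf.expectation P f \<le> measure_pmf.expectation P g"
  by (intro integral_mono_AE integrable_measure_pmf_finite)
     (use assms in \<open>auto simp: AE_measure_pmf_iff\<close>)

text \<open>A bound conditional on the first stage may be integrated over that stage. Used to chain
  slots into trials and trials into runs.\<close>

lemma expectation_bind_le:
  fixes h :: "'b \<Rightarrow> real"
  assumes P: "finite (set_pmf P)"
    and F: "\<And>x. x \<in> set_pmf P \<Longrightarrow> finite (set_pmf (F x))"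
    and le: "\<And>x. x \<in> set_pmf P \<Longrightarrow> measure_pmf.expectation (F x) h \<le> g x"
  shows "measure_pmf.expectation (bind_pmf P F) h \<le> measure_pmf.expectation P g"
proof -
  have "measure_pmf.expectation (bind_pmf P F) h
      = (\<Sum>x\<in>set_pmf P. pmf P x * measure_pmf.expectation (F x) h)"
    using pmf_expectation_bind[OF P F order_refl, where h = h] by simp
  also have "\<dots> \<le> (\<Sum>x\<in>set_pmf P. pmf P x * g x)"
    by (intro sum_mono mult_left_mono le) auto
  also have "\<dots> = measure_pmf.expectation P g"
    by (subst integral_measure_pmf[of "set_pmf P"]) (use P in auto)
  finally show ?thesis .
qed

text \<open>Every point of the support has positive mass, so a vanishing mean becomes a sure
  statement. This makes the final cover certain rather than likely.\<close>

lemma expectation_nonpos_imp_zero: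
  fixes f :: "'a \<Rightarrow> real"
  assumes fin: "finite (set_pmf P)" and nn: "\<And>x. x \<in> set_pmf P \<Longrightarrow> 0 \<le> f x"
    and le: "measure_pmf.expectation P f \<le> 0" and x: "x \<in> set_pmf P"
  shows "f x = 0"
proof -
  have "measure_pmf.expectation P f = (\<Sum>y\<in>set_pmf P. pmf P y * f y)"
    by (subst integral_measure_pmf[of "set_pmf P"]) (use fin in auto)
  moreover have "pmf P x * f x \<le> (\<Sum>y\<in>set_pmf P. pmf P y * f y)"
    using nn fin x by (intro member_le_sum) auto
  ultimately have "pmf P x * f x \<le> 0" using le by simp
  moreover have "pmf P x > 0" using x by (simp add: pmf_positive)
  ultimately show ?thesis
    using nn[OF x] by (simp add: mult_le_0_iff)
qed

section \<open>Independent random subsets\<close>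

text \<open>Models the set of nodes that beep in one slot; \<open>f v\<close> is the beep
  probability of \<open>v\<close>.\<close>

definition random_subset :: "'a set \<Rightarrow> ('a \<Rightarrow> real) \<Rightarrow> 'a set pmf" where
  "random_subset V f = map_pmf (\<lambda>w. {v\<in>V. w v}) (Pi_pmf V False (\<lambda>v. bernoulli_pmf (f v)))"

lemma random_subset_cong:
  "(\<And>v. v \<in> V \<Longrightarrow> f v = g v) \<Longrightarrow> finite V \<Longrightarrow> random_subset V f = random_subset V g"
  unfolding random_subset_def by (intro arg_cong[where f = "map_pmf _"] Pi_pmf_cong) auto

lemma finite_set_random_subset:
  assumes "finite V"
  shows "finite (set_pmf (random_subset V f))"
proof (rule finite_subset)
  show "set_pmf (random_subset V f) \<subseteq> Pow V" by (auto simp: random_subset_def)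
qed (use assms in auto)

text \<open>Confines the beepers to the nodes of nonzero rate: uncovered elements in a test, active
  sets when joining.\<close>

lemma in_random_subset:
  assumes "finite V" "B \<in> set_pmf (random_subset V f)" "v \<in> B"
  shows "v \<in> V \<and> f v \<noteq> 0"
proof -
  have "\<exists>w\<in>PiE_dflt V False (set_pmf \<circ> (\<lambda>v. bernoulli_pmf (f v))). B = {v \<in> V. w v}"
    using assms(1,2) by (auto simp: random_subset_def set_Pi_pmf)
  then obtain w where w: "w \<in> PiE_dflt V False (set_pmf \<circ> (\<lambda>v. bernoulli_pmf (f v)))"
    and B: "B = {v\<in>V. w v}" by blast
  have "v \<in> V" "w v" using B assms(3) by auto
  hence "True \<in> set_pmf (bernoulli_pmf (f v))"
    using w by (force simp: PiE_dflt_def)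
  hence "f v \<noteq> 0" by (auto simp: set_pmf_eq)
  with \<open>v \<in> V\<close> show ?thesis by simp
qed

lemma random_subset_all:
  assumes "finite V" "B \<in> set_pmf (random_subset V f)" "v \<in> V" "f v = 1"
  shows "v \<in> B"
proof -
  have "\<exists>w\<in>PiE_dflt V False (set_pmf \<circ> (\<lambda>v. bernoulli_pmf (f v))). B = {v \<in> V. w v}"
    using assms(1,2) by (auto simp: random_subset_def set_Pi_pmf)
  then obtain w where w: "w \<in> PiE_dflt V False (set_pmf \<circ> (\<lambda>v. bernoulli_pmf (f v)))"
    and B: "B = {v\<in>V. w v}" by blast
  have "w v \<in> set_pmf (bernoulli_pmf (f v))"
    using w assms(3) by (force simp: PiE_dflt_def)
  hence "w v" using assms(4) by (cases "w v") (auto simp: set_pmf_eq)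
  thus ?thesis using B assms(3) by simp
qed

lemma random_subset_avoid:
  assumes V: "finite V" and S: "S \<subseteq> V" and f: "\<And>v. v \<in> V \<Longrightarrow> 0 \<le> f v \<and> f v \<le> 1"
  shows "measure_pmf.expectation (random_subset V f) (\<lambda>B. of_bool (S \<inter> B = {}))
         = (\<Prod>v\<in>S. 1 - f v)"
proof -
  let ?h = "\<lambda>v x. of_bool (\<not> (v \<in> S \<and> x)) :: real"
  \<comment> \<open>Avoiding \<open>S\<close> is a product of indicators, one per node, so
    independence turns its expectation into a product of expectations.\<close>
  have ind: "of_bool (S \<inter> {v\<in>V. w v} = {}) = (\<Prod>v\<in>V. ?h v (w v))" for w
  proof (cases "S \<inter> {v\<in>V. w v} = {}")
    case True
    hence "(\<Prod>v\<in>V. ?h v (w v)) = (\<Prod>v\<in>V. 1)" by (intro prod.cong) auto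
    thus ?thesis using True by simp
  next
    case False
    hence "\<exists>v\<in>V. ?h v (w v) = 0" by auto
    hence "(\<Prod>v\<in>V. ?h v (w v)) = 0" using V by (subst prod_zero_iff) auto
    thus ?thesis using False by simp
  qed
  have "measure_pmf.expectation (random_subset V f) (\<lambda>B. of_bool (S \<inter> B = {}))
    = measure_pmf.expectation (Pi_pmf V False (\<lambda>v. bernoulli_pmf (f v))) (\<lambda>w. \<Prod>v\<in>V. ?h v (w v))"
    by (simp only: random_subset_def integral_map_pmf ind)
  also have "\<dots> = (\<Prod>v\<in>V. measure_pmf.expectation (bernoulli_pmf (f v)) (?h v))"
    by (rule expectation_prod_Pi_pmf[OF V]) (auto intro: integrable_measure_pmf_finite)
  also have "\<dots> = (\<Prod>v\<in>V. if v \<in> S then 1 - f v else 1)"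
    by (intro prod.cong refl) (use f in auto)
  also have "\<dots> = (\<Prod>v\<in>S. 1 - f v)"
    using V S by (simp add: prod.If_cases Int_absorb1)
  finally show ?thesis .
qed

lemma random_subset_in:
  assumes V: "finite V" and v: "v \<in> V" and f: "\<And>v. v \<in> V \<Longrightarrow> 0 \<le> f v \<and> f v \<le> 1"
  shows "measure_pmf.expectation (random_subset V f) (\<lambda>B. of_bool (v \<in> B)) = f v"
proof -
  have "measure_pmf.expectation (random_subset V f) (\<lambda>B. of_bool (v \<in> B))
     = measure_pmf.expectation (random_subset V f) (\<lambda>B. 1 - of_bool ({v} \<inter> B = {}) :: real)"
    by (intro Bochner_Integration.integral_cong) auto
  also have "\<dots> = 1 - measure_pmf.expectation (random_subset V f) (\<lambda>B. of_bool ({v} \<inter> B = {}))"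
    by (subst Bochner_Integration.integral_diff)
       (intro integrable_measure_pmf_finite finite_set_random_subset V | simp)+
  also have "\<dots> = f v"
    by (subst random_subset_avoid[OF V _ f]) (use v in auto)
  finally show ?thesis .
qed

text \<open>The beep bit is the only randomness in \<open>step\<close>; the update is a function of
  it and of what is heard. So a slot is determined by its set of beepers.\<close>

lemma beep_round_random_subset:
  assumes V: "finite V"
    and step: "\<And>s. step s = map_pmf (\<lambda>b. (b, upd s b)) (bernoulli_pmf (pr s))"
  shows "beep_round V M step c =
    map_pmf (\<lambda>B v. if v \<in> V then upd (c v) (v \<in> B) (v \<notin> B \<and> (\<exists>u\<in>B. adj M u v)) else c v)
      (random_subset V (\<lambda>v. pr (c v)))"
proof -
  let ?P = "Pi_pmf V False (\<lambda>v. bernoulli_pmf (pr (c v)))"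
  have "Pi_pmf V undefined (\<lambda>v. step (c v))
     = Pi_pmf V undefined (\<lambda>v. bind_pmf (bernoulli_pmf (pr (c v))) (\<lambda>b. return_pmf (b, upd (c v) b)))"
    by (simp add: step map_pmf_def)
  \<comment> \<open>The coins default to \<open>False\<close> outside \<open>V\<close>, while the
    node choices must keep the default \<open>undefined\<close> there; hence the case
    distinction.\<close>
  also have "\<dots> = map_pmf (\<lambda>w v. if v \<in> V then (w v, upd (c v) (w v)) else undefined) ?P"
    by (subst Pi_pmf_bind[OF V, where d' = False]) (simp add: map_pmf_def V)
  finally have *: "Pi_pmf V undefined (\<lambda>v. step (c v))
     = map_pmf (\<lambda>w v. if v \<in> V then (w v, upd (c v) (w v)) else undefined) ?P" .
  show ?thesis
    unfolding beep_round_def random_subset_def * map_pmf_comp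
    by (intro map_pmf_cong refl ext) (simp add: heard_def conj_ac Bex_def cong: conj_cong)
qed

section \<open>The two slots of a trial\<close>

type_synonym 'v cfg = "'v set \<times> 'v set \<times> 'v set"

locale cover_instance =
  fixes VS VU :: "'v set" and M :: "('v \<times> 'v) set"
  assumes wf: "wf_instance VS VU M"
begin

definition residual :: "'v set \<Rightarrow> 'v \<Rightarrow> nat" where
  "residual U s = card {e\<in>U. (s, e) \<in> M}"

definition sup_deg :: "'v set \<Rightarrow> 'v \<Rightarrow> nat" where
  "sup_deg A e = card {s\<in>A. (s, e) \<in> M}"

text \<open>A configuration \<open>(A, J, U)\<close> consists of the active sets, the sets that have joined the cover,
  and the uncovered elements.\<close>

definition test_slot :: "real \<Rightarrow> 'v cfg \<Rightarrow> 'v cfg pmf" where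
  "test_slot b = (\<lambda>(A, J, U).
     map_pmf (\<lambda>B. ({s\<in>A. \<exists>e\<in>B. adj M e s}, J, U))
       (random_subset (VS \<union> VU) (\<lambda>v. if v \<in> U then b else 0)))"

text \<open>A joined set stays in \<open>A\<close>, but it has no uncovered elements left, so it
  hears nothing in the next test and drops out then.\<close>

definition join_slot :: "real \<Rightarrow> 'v cfg \<Rightarrow> 'v cfg pmf" where
  "join_slot p = (\<lambda>(A, J, U).
     map_pmf (\<lambda>B. (A, J \<union> B, {e\<in>U. \<not> (\<exists>s\<in>B. adj M s e)}))
       (random_subset (VS \<union> VU) (\<lambda>v. if v \<in> A then p else 0)))"

definition trial :: "real \<Rightarrow> real \<Rightarrow> 'v cfg \<Rightarrow> 'v cfg pmf" where
  "trial b p x = bind_pmf (test_slot b x) (join_slot p)"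

text \<open>The invariant of a run. By its last clause \<open>J\<close> is a cover as soon as
  \<open>U\<close> is empty.\<close>

definition valid :: "'v cfg \<Rightarrow> bool" where
  "valid = (\<lambda>(A, J, U). A \<subseteq> VS \<and> J \<subseteq> VS \<and> U \<subseteq> VU \<and> (\<forall>e\<in>VU - U. \<exists>s\<in>J. (s, e) \<in> M))"

lemma fin: "finite VS" "finite VU" "finite (VS \<union> VU)"
  and disj: "VS \<inter> VU = {}" and M_sub: "M \<subseteq> VS \<times> VU"
  using wf by (auto simp: wf_instance_def)

lemma adj_set_iff: "s \<in> VS \<Longrightarrow> adj M e s \<longleftrightarrow> (s, e) \<in> M"
  and adj_elem_iff: "e \<in> VU \<Longrightarrow> adj M s e \<longleftrightarrow> (s, e) \<in> M"
  using disj M_sub by (auto simp: adj_def)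

lemma finite_test_slot: "finite (set_pmf (test_slot b x))"
  and finite_join_slot: "finite (set_pmf (join_slot p x))"
  by (auto simp: test_slot_def join_slot_def split_beta finite_set_random_subset fin)

lemma finite_trial: "finite (set_pmf (trial b p x))"
  by (auto simp: trial_def finite_test_slot finite_join_slot)

lemma valid_test_slot: "valid x \<Longrightarrow> y \<in> set_pmf (test_slot b x) \<Longrightarrow> valid y"
  by (auto simp: test_slot_def valid_def split_beta)

lemma valid_join_slot:
  assumes x: "valid x" and y: "y \<in> set_pmf (join_slot p x)"
  shows "valid y"
proof -
  obtain A J U where [simp]: "x = (A, J, U)" by (cases x)
  obtain B where B: "B \<in> set_pmf (random_subset (VS \<union> VU) (\<lambda>v. if v \<in> A then p else 0))"
    and y': "y = (A, J \<union> B, {e\<in>U. \<not> (\<exists>s\<in>B. adj M s e)})"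
    using y by (auto simp: join_slot_def)
  have "B \<subseteq> A" using in_random_subset[OF fin(3) B] by (force split: if_splits)
  moreover have "\<exists>s\<in>J \<union> B. (s, e) \<in> M"
    if e: "e \<in> VU" and n: "\<not> (e \<in> U \<and> \<not> (\<exists>s\<in>B. adj M s e))" for e
    using n x e adj_elem_iff[OF e] unfolding valid_def by auto
  ultimately show ?thesis
    using x unfolding y' by (auto simp: valid_def)
qed

lemma valid_trial: "valid x \<Longrightarrow> y \<in> set_pmf (trial b p x) \<Longrightarrow> valid y"
  by (auto simp: trial_def intro: valid_test_slot valid_join_slot)

section \<open>Cost and progress of one trial\<close>

text \<open>Each set that passes is charged to a beeping element it contains. An element
  \<open>e\<close> receives at most \<open>sup_deg A e\<close> charges, and only if it
  beeps.\<close>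

lemma expectation_card_test:
  assumes v: "valid (A, J, U)" and b: "0 \<le> b" "b \<le> 1"
  shows "measure_pmf.expectation (test_slot b (A, J, U)) (\<lambda>(A', J', U'). real (card A'))
         \<le> b * (\<Sum>e\<in>U. real (sup_deg A e))"
proof -
  let ?f = "\<lambda>v. if v \<in> U then b else 0"
  let ?P = "random_subset (VS \<union> VU) ?f"
  have sub: "A \<subseteq> VS" "U \<subseteq> VU" using v by (auto simp: valid_def)
  have finA: "finite A" "finite U" using sub fin finite_subset by auto
  have fP: "finite (set_pmf ?P)" by (rule finite_set_random_subset[OF fin(3)])
  have "measure_pmf.expectation (test_slot b (A, J, U)) (\<lambda>(A', J', U'). real (card A'))
     = measure_pmf.expectation ?P (\<lambda>B. real (card {s\<in>A. \<exists>e\<in>B. adj M e s}))"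
    by (simp add: test_slot_def)
  also have "\<dots> \<le> measure_pmf.expectation ?P (\<lambda>B. \<Sum>e\<in>U. real (sup_deg A e) * of_bool (e \<in> B))"
  proof (rule expectation_mono_finite[OF fP])
    fix B assume "B \<in> set_pmf ?P"
    from in_random_subset[OF fin(3) this] have BU: "B \<subseteq> U" by (force split: if_splits)
    have "{s\<in>A. \<exists>e\<in>B. adj M e s} \<subseteq> (\<Union>e\<in>B. {s\<in>A. (s, e) \<in> M})"
      using sub adj_set_iff by blast
    hence "card {s\<in>A. \<exists>e\<in>B. adj M e s} \<le> card (\<Union>e\<in>B. {s\<in>A. (s, e) \<in> M})"
      using finA BU by (intro card_mono) (auto intro: finite_subset)
    also have "\<dots> \<le> (\<Sum>e\<in>B. sup_deg A e)"
      unfolding sup_deg_def using finA BU by (intro card_UN_le) (auto intro: finite_subset)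
    finally have "real (card {s\<in>A. \<exists>e\<in>B. adj M e s}) \<le> real (\<Sum>e\<in>B. sup_deg A e)"
      by (simp only: of_nat_le_iff)
    also have "\<dots> = (\<Sum>e\<in>U. real (sup_deg A e) * of_bool (e \<in> B))"
      unfolding of_nat_sum using BU finA by (intro sum.mono_neutral_cong_left) auto
    finally show "real (card {s\<in>A. \<exists>e\<in>B. adj M e s}) \<le> \<dots>" .
  qed
  also have "\<dots> = (\<Sum>e\<in>U. real (sup_deg A e) * measure_pmf.expectation ?P (\<lambda>B. of_bool (e \<in> B)))"
    by (subst Bochner_Integration.integral_sum)
       (auto intro!: integrable_measure_pmf_finite finite_set_random_subset fin)
  also have "\<dots> = (\<Sum>e\<in>U. real (sup_deg A e) * b)"
    using sub b by (intro sum.cong refl) (subst random_subset_in, auto simp: fin)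
  finally show ?thesis by (simp add: sum_distrib_left mult.commute)
qed

text \<open>Joining costs \<open>p\<close> per active set. An element with \<open>a\<close> active
  sets carries the weight \<open>c * (1 + a * p)\<close> only if none of them beeps, which has
  probability \<open>(1 - p) ^ a\<close>, so on average the weight is at most \<open>c\<close>.
  Applied with \<open>c = b * q\<close>.\<close>

lemma expectation_join_potential:
  assumes v: "valid (A, J, U)" and p: "0 \<le> p" "p \<le> 1" and c: "0 \<le> c"
  shows "measure_pmf.expectation (join_slot p (A, J, U))
           (\<lambda>(A', J', U'). real (card J') + c * p * (\<Sum>e\<in>U'. real (sup_deg A' e)) + c * real (card U'))
         \<le> real (card J) + p * real (card A) + c * real (card U)"
proof -
  let ?f = "\<lambda>v. if v \<in> A then p else 0"
  let ?P = "random_subset (VS \<union> VU) ?f"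
  let ?N = "\<lambda>e. {s\<in>A. (s, e) \<in> M}"
  have sub: "A \<subseteq> VS" "U \<subseteq> VU" "J \<subseteq> VS" using v by (auto simp: valid_def)
  have finA: "finite A" "finite U" "finite J" using sub fin finite_subset by auto
  have fP: "finite (set_pmf ?P)" by (rule finite_set_random_subset[OF fin(3)])
  have int: "integrable (measure_pmf ?P) g" for g :: "_ \<Rightarrow> real"
    by (rule integrable_measure_pmf_finite[OF fP])
  have "measure_pmf.expectation (join_slot p (A, J, U))
           (\<lambda>(A', J', U'). real (card J') + c * p * (\<Sum>e\<in>U'. real (sup_deg A' e)) + c * real (card U'))
     = measure_pmf.expectation ?P (\<lambda>B. real (card (J \<union> B))
         + c * p * (\<Sum>e\<in>{e\<in>U. \<not> (\<exists>s\<in>B. adj M s e)}. real (sup_deg A e))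
         + c * real (card {e\<in>U. \<not> (\<exists>s\<in>B. adj M s e)}))"
    by (simp add: join_slot_def)
  also have "\<dots> \<le> measure_pmf.expectation ?P (\<lambda>B. real (card J) + (\<Sum>s\<in>A. of_bool (s \<in> B))
         + (\<Sum>e\<in>U. c * (1 + real (sup_deg A e) * p) * of_bool (?N e \<inter> B = {})))"
  proof (rule expectation_mono_finite[OF fP])
    fix B assume "B \<in> set_pmf ?P"
    from in_random_subset[OF fin(3) this] have BA: "B \<subseteq> A" by (force split: if_splits)
    have "real (card (J \<union> B)) \<le> real (card J) + real (card B)"
      using card_Un_le[of J B] by linarith
    also have "real (card B) = (\<Sum>s\<in>A. of_bool (s \<in> B))"
      using BA finA by (simp add: Int_absorb1 flip: Int_def)
    finally have 1: "real (card (J \<union> B)) \<le> real (card J) + (\<Sum>s\<in>A. of_bool (s \<in> B))" .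
    have U': "{e\<in>U. \<not> (\<exists>s\<in>B. adj M s e)} = {e\<in>U. ?N e \<inter> B = {}}"
      using sub BA adj_elem_iff by blast
    have "c * p * (\<Sum>e\<in>{e\<in>U. \<not> (\<exists>s\<in>B. adj M s e)}. real (sup_deg A e))
         + c * real (card {e\<in>U. \<not> (\<exists>s\<in>B. adj M s e)})
       = (\<Sum>e\<in>{e\<in>U. ?N e \<inter> B = {}}. c * (1 + real (sup_deg A e) * p))"
      unfolding U' by (simp add: sum.distrib sum_distrib_left algebra_simps)
    also have "\<dots> = (\<Sum>e\<in>U. c * (1 + real (sup_deg A e) * p) * of_bool (?N e \<inter> B = {}))"
      using finA by (intro sum.mono_neutral_cong_left) auto
    finally show "real (card (J \<union> B))
         + c * p * (\<Sum>e\<in>{e\<in>U. \<not> (\<exists>s\<in>B. adj M s e)}. real (sup_deg A e))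
         + c * real (card {e\<in>U. \<not> (\<exists>s\<in>B. adj M s e)})
       \<le> real (card J) + (\<Sum>s\<in>A. of_bool (s \<in> B))
         + (\<Sum>e\<in>U. c * (1 + real (sup_deg A e) * p) * of_bool (?N e \<inter> B = {}))"
      using 1 by linarith
  qed
  also have "\<dots> = real (card J) + (\<Sum>s\<in>A. measure_pmf.expectation ?P (\<lambda>B. of_bool (s \<in> B)))
         + (\<Sum>e\<in>U. c * (1 + real (sup_deg A e) * p)
              * measure_pmf.expectation ?P (\<lambda>B. of_bool (?N e \<inter> B = {})))"
    by (simp add: int Bochner_Integration.integral_add Bochner_Integration.integral_sum)
  also have "(\<Sum>s\<in>A. measure_pmf.expectation ?P (\<lambda>B. of_bool (s \<in> B))) = (\<Sum>s\<in>A. p)"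
    using sub p by (intro sum.cong refl) (subst random_subset_in, auto simp: fin)
  also have "(\<Sum>e\<in>U. c * (1 + real (sup_deg A e) * p)
              * measure_pmf.expectation ?P (\<lambda>B. of_bool (?N e \<inter> B = {}))) \<le> (\<Sum>e\<in>U. c)"
  proof (rule sum_mono)
    fix e assume "e \<in> U"
    have "measure_pmf.expectation ?P (\<lambda>B. of_bool (?N e \<inter> B = {})) = (\<Prod>s\<in>?N e. 1 - ?f s)"
      using sub p by (intro random_subset_avoid fin) auto
    also have "\<dots> = (\<Prod>s\<in>?N e. 1 - p)" by (intro prod.cong) auto
    also have "\<dots> = (1 - p) ^ sup_deg A e" by (simp add: sup_deg_def)
    finally show "c * (1 + real (sup_deg A e) * p)
              * measure_pmf.expectation ?P (\<lambda>B. of_bool (?N e \<inter> B = {})) \<le> c"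
      using mult_left_mono[OF mult_power_Bernoulli_le[OF p, of "sup_deg A e"] c]
      by (simp add: mult_ac)
  qed
  finally show ?thesis by (simp add: algebra_simps)
qed

text \<open>A set that stays inactive for the rest of the phase keeps its residual elements; a test
  deactivates a set with \<open>r\<close> residual elements with probability \<open>(1 - b) ^ r\<close> only.\<close>

lemma expectation_trial_inactive:
  fixes b d p :: real
  assumes v: "valid (A, J, U)" and b: "0 \<le> b" "b \<le> 1"
    and s: "s \<in> VS" and d: "\<And>n. real n * (1 - b) ^ n \<le> d"
  shows "measure_pmf.expectation (trial b p (A, J, U))
           (\<lambda>(A', J', U'). of_bool (s \<notin> A' \<or> p = 1) * real (residual U' s))
         \<le> of_bool (s \<notin> A) * real (residual U s) + d"
proof -
  have sub: "A \<subseteq> VS" "U \<subseteq> VU" using v by (auto simp: valid_def)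
  have finU: "finite U" using sub fin finite_subset by auto
  have d0: "0 \<le> d" using d[of 0] by simp
  let ?P = "random_subset (VS \<union> VU) (\<lambda>v. if v \<in> U then b else 0)"
  let ?N = "{e\<in>U. (s, e) \<in> M}"
  \<comment> \<open>\<open>?g\<close> is read off after the test, \<open>?h\<close> after the join.
    A set still active is counted by \<open>?h\<close> only if \<open>p = 1\<close>; then it joins
    surely and its residual is 0. This lets the last trial of a phase be treated like the
    others.\<close>
  let ?g = "\<lambda>(A', J', U'). of_bool (s \<notin> A') * real (residual U' s)"
  let ?h = "\<lambda>(A', J', U'). of_bool (s \<notin> A' \<or> p = 1) * real (residual U' s)"
  have "measure_pmf.expectation (trial b p (A, J, U)) ?h
      \<le> measure_pmf.expectation (test_slot b (A, J, U)) ?g"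
    unfolding trial_def
  proof (rule expectation_bind_le)
    fix x assume x: "x \<in> set_pmf (test_slot b (A, J, U))"
    obtain A' J' U' where [simp]: "x = (A', J', U')" by (cases x)
    have "valid x" using valid_test_slot[OF v x] .
    hence sub': "A' \<subseteq> VS" "U' \<subseteq> VU" by (auto simp: valid_def)
    have finU': "finite U'" using sub' fin finite_subset by auto
    let ?Q = "random_subset (VS \<union> VU) (\<lambda>v. if v \<in> A' then p else 0)"
    have "measure_pmf.expectation (join_slot p x) ?h
        \<le> measure_pmf.expectation (join_slot p x) (\<lambda>_. ?g x)"
    proof (rule expectation_mono_finite[OF finite_join_slot])
      fix y assume "y \<in> set_pmf (join_slot p x)"
      then obtain B where B: "B \<in> set_pmf ?Q"
        and y: "y = (A', J' \<union> B, {e\<in>U'. \<not> (\<exists>s\<in>B. adj M s e)})"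
        by (auto simp: join_slot_def)
      let ?U = "{e\<in>U'. \<not> (\<exists>s\<in>B. adj M s e)}"
      have mono: "residual ?U s \<le> residual U' s"
        unfolding residual_def using finU' by (intro card_mono) auto
      have "residual ?U s = 0" if "s \<in> A'" "p = 1"
      proof -
        have "s \<in> B" using random_subset_all[OF fin(3) B, of s] that s by auto
        hence "{e\<in>?U. (s, e) \<in> M} = {}" by (auto simp: adj_def)
        thus ?thesis by (simp only: residual_def card.empty)
      qed
      thus "?h y \<le> ?g x" using mono y by auto
    qed
    thus "measure_pmf.expectation (join_slot p x) ?h \<le> ?g x" by simp
  qed (rule finite_test_slot finite_join_slot)+
  also have "\<dots> = measure_pmf.expectation ?P
       (\<lambda>B. of_bool (\<not> (s \<in> A \<and> (\<exists>e\<in>B. adj M e s))) * real (residual U s))"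
    by (simp add: test_slot_def)
  \<comment> \<open>An inactive set is already counted in full by the first summand. An active one
    starts with weight 0 and is counted only if it fails the test, which \<open>d\<close> pays
    for.\<close>
  also have "\<dots> \<le> of_bool (s \<notin> A) * real (residual U s) + d"
  proof (cases "s \<in> A")
    case False
    thus ?thesis using d0 by simp
  next
    case True
    have fP: "finite (set_pmf ?P)" by (rule finite_set_random_subset[OF fin(3)])
    have "measure_pmf.expectation ?P
       (\<lambda>B. of_bool (\<not> (s \<in> A \<and> (\<exists>e\<in>B. adj M e s))) * real (residual U s))
      \<le> measure_pmf.expectation ?P (\<lambda>B. of_bool (?N \<inter> B = {}) * real (residual U s))"
      by (rule expectation_mono_finite[OF fP]) (use True in \<open>auto simp: adj_def\<close>)
    also have "\<dots> = measure_pmf.expectation ?P (\<lambda>B. of_bool (?N \<inter> B = {})) * real (residual U s)"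
      by simp
    also have "measure_pmf.expectation ?P (\<lambda>B. of_bool (?N \<inter> B = {}))
        = (\<Prod>e\<in>?N. 1 - (if e \<in> U then b else 0))"
      using sub b by (intro random_subset_avoid fin) auto
    also have "(\<Prod>e\<in>?N. 1 - (if e \<in> U then b else 0)) = (\<Prod>e\<in>?N. 1 - b)"
      by (intro prod.cong) auto
    also have "(\<Prod>e\<in>?N. 1 - b) * real (residual U s) \<le> d"
      using d[of "residual U s"] by (simp add: residual_def mult.commute)
    finally show ?thesis using True by simp
  qed
  finally show ?thesis .
qed

text \<open>The term \<open>b p \<Sum> deg\<close> pays for the sets that join now, at rate \<open>p\<close>; the term \<open>b q |U|\<close>
  refills it for the next rate \<open>p' \<le> q p\<close>, because an element with \<open>a\<close> active sets remains
  uncovered with probability \<open>(1 - p) ^ a\<close>, which outweighs the growth by \<open>1 + a p\<close>.\<close>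

definition potential :: "real \<Rightarrow> real \<Rightarrow> real \<Rightarrow> 'v cfg \<Rightarrow> real" where
  "potential b q p = (\<lambda>(A, J, U).
     real (card J) + b * p * (\<Sum>e\<in>U. real (sup_deg A e)) + b * q * real (card U))"

text \<open>Read backwards: since \<open>p' \<le> q * p\<close>, the join bound with
  \<open>c = b * q\<close> reduces the final potential to the mean of
  \<open>|J| + p * |A| + b * q * |U|\<close> after the test, and the test bound turns
  \<open>p * |A|\<close> into \<open>b * p\<close> times the degree sum.\<close>

lemma expectation_trial_potential:
  assumes v: "valid x" and b: "0 \<le> b" "b \<le> 1" and p: "0 \<le> p" "p \<le> 1"
    and q: "0 \<le> q" and p': "p' \<le> q * p"
  shows "measure_pmf.expectation (trial b p x) (potential b q p') \<le> potential b q p x"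
proof -
  obtain A J U where x: "x = (A, J, U)" by (cases x)
  let ?g = "\<lambda>(A', J', U'). real (card J') + p * real (card A') + b * q * real (card U')"
  have "measure_pmf.expectation (trial b p x) (potential b q p')
      \<le> measure_pmf.expectation (test_slot b x) ?g"
    unfolding trial_def
  proof (rule expectation_bind_le)
    fix y assume y: "y \<in> set_pmf (test_slot b x)"
    obtain A' J' U' where [simp]: "y = (A', J', U')" by (cases y)
    have vy: "valid (A', J', U')" using valid_test_slot[OF v y] by simp
    have c: "0 \<le> b * q" using b q by simp
    have "measure_pmf.expectation (join_slot p y) (potential b q p')
       \<le> measure_pmf.expectation (join_slot p y)
           (\<lambda>(A', J', U'). real (card J') + b * q * p * (\<Sum>e\<in>U'. real (sup_deg A' e)) + b * q * real (card U'))"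
    proof (rule expectation_mono_finite[OF finite_join_slot])
      fix z assume "z \<in> set_pmf (join_slot p y)"
      obtain A'' J'' U'' where [simp]: "z = (A'', J'', U'')" by (cases z)
      have "b * p' * (\<Sum>e\<in>U''. real (sup_deg A'' e)) \<le> b * q * p * (\<Sum>e\<in>U''. real (sup_deg A'' e))"
        using mult_left_mono[OF p' b(1)] by (intro mult_right_mono sum_nonneg) (auto simp: mult_ac)
      thus "potential b q p' z \<le> (case z of (A', J', U') \<Rightarrow>
          real (card J') + b * q * p * (\<Sum>e\<in>U'. real (sup_deg A' e)) + b * q * real (card U'))"
        by (simp add: potential_def)
    qed
    also have "\<dots> \<le> ?g y"
      using expectation_join_potential[OF vy p c] by simp
    finally show "measure_pmf.expectation (join_slot p y) (potential b q p') \<le> ?g y" .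
  qed (rule finite_test_slot finite_join_slot)+
  also have "\<dots> = measure_pmf.expectation (test_slot b x)
      (\<lambda>y. real (card J) + b * q * real (card U) + p * (case y of (A', J', U') \<Rightarrow> real (card A')))"
    by (simp add: x test_slot_def add_ac)
  also have "\<dots> = real (card J) + b * q * real (card U)
      + p * measure_pmf.expectation (test_slot b x) (\<lambda>(A', J', U'). real (card A'))"
    by (subst Bochner_Integration.integral_add)
       (auto intro: integrable_measure_pmf_finite finite_test_slot)
  also have "\<dots> \<le> real (card J) + b * q * real (card U) + p * (b * (\<Sum>e\<in>U. real (sup_deg A e)))"
    using expectation_card_test[of A J U b] v b p x by (intro add_left_mono mult_left_mono) auto
  also have "\<dots> = potential b q p x"
    by (simp add: potential_def x)
  finally show ?thesis .
qed

end

section \<open>The schedule\<close>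

text \<open>A geometric scale from \<open>1 / q ^ K\<close> to \<open>1\<close>, where
  \<open>q ^ K\<close> stands for \<open>\<Delta>\<close>. It supplies both the test and the join
  probabilities.\<close>

definition rate :: "real \<Rightarrow> nat \<Rightarrow> nat \<Rightarrow> real" where
  "rate q K i = q ^ i / q ^ K"

locale schedule = cover_instance VS VU M for VS VU :: "'v set" and M +
  fixes K :: nat and q :: real
  assumes q: "1 \<le> q" and deg: "v \<in> VS \<union> VU \<Longrightarrow> real (degree M v) \<le> q ^ K"
begin

lemma rate_pos: "0 < rate q K i"
  and rate_Suc: "rate q K (Suc i) = q * rate q K i"
  and rate_K: "rate q K K = 1"
  using q by (auto simp: rate_def)

lemma rate_le_1: "i \<le> K \<Longrightarrow> rate q K i \<le> 1"
  using q by (auto simp: rate_def intro: power_increasing)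

text \<open>Trial \<open>i * Suc K + j\<close> is trial \<open>j\<close> of phase \<open>i\<close>; every phase starts with all sets active.\<close>

definition reset :: "nat \<Rightarrow> 'v cfg \<Rightarrow> 'v cfg" where
  "reset n = (\<lambda>(A, J, U). (if n mod Suc K = 0 then VS else A, J, U))"

primrec run :: "nat \<Rightarrow> 'v cfg pmf" where
  "run 0 = return_pmf (VS, {}, VU)"
| "run (Suc n) = bind_pmf (run n)
     (\<lambda>x. trial (rate q K (n div Suc K)) (rate q K (n mod Suc K)) (reset n x))"

lemma finite_run: "finite (set_pmf (run n))"
  by (induction n) (auto simp: finite_trial)

lemma valid_reset: "valid x \<Longrightarrow> valid (reset n x)"
  by (auto simp: reset_def valid_def split: prod.splits)

lemma valid_run: "x \<in> set_pmf (run n) \<Longrightarrow> valid x"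
proof (induction n arbitrary: x)
  case 0
  thus ?case by (simp add: valid_def)
next
  case (Suc n)
  then obtain y where "y \<in> set_pmf (run n)"
    "x \<in> set_pmf (trial (rate q K (n div Suc K)) (rate q K (n mod Suc K)) (reset n y))"
    by auto
  thus ?case using Suc.IH valid_trial valid_reset by blast
qed

lemma phase_index: "m \<le> K \<Longrightarrow> (i * Suc K + m) div Suc K = i \<and> (i * Suc K + m) mod Suc K = m"
  by (metis add.commute add_cancel_right_left div_less div_mult_self1 le_imp_less_Suc
      mod_less mod_mult_self1 nat.simps(3))

lemma reset_first: "reset (i * Suc K) (A, J, U) = (VS, J, U)"
  unfolding reset_def by (simp del: mult_Suc_right)

lemma reset_later: "Suc m \<le> K \<Longrightarrow> reset (Suc (i * Suc K + m)) x = x"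
  unfolding reset_def using phase_index[of "Suc m" i] by (simp del: mult_Suc_right add: split_beta)

lemma run_Suc:
  assumes "m \<le> K"
  shows "run (Suc (i * Suc K + m)) = bind_pmf (run (i * Suc K + m))
    (\<lambda>x. trial (rate q K i) (rate q K m) (reset (i * Suc K + m) x))"
  using phase_index[OF assms] by simp

section \<open>Cost of one phase\<close>

lemma phase_potential:
  assumes i: "i \<le> K" and m: "m \<le> K"
  shows "measure_pmf.expectation (run (i * Suc K + m))
           (\<lambda>x. potential (rate q K i) q (rate q K m) (reset (i * Suc K + m) x))
    \<le> measure_pmf.expectation (run (i * Suc K))
         (\<lambda>(A, J, U). real (card J) + rate q K i * (1 + q) * real (card U))"
  using m
proof (induction m)
  case 0
  show ?case
  proof (simp only: add_0_right, rule expectation_mono_finite[OF finite_run])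
    fix x assume "x \<in> set_pmf (run (i * Suc K))"
    hence v: "valid x" by (rule valid_run)
    obtain A J U where [simp]: "x = (A, J, U)" by (cases x)
    have "(\<Sum>e\<in>U. real (sup_deg VS e)) \<le> (\<Sum>e\<in>U. q ^ K)"
    proof (rule sum_mono)
      fix e assume "e \<in> U"
      hence e: "e \<in> VU" using v by (auto simp: valid_def)
      have "{s. adj M s e} \<subseteq> VS \<union> VU" using M_sub by (auto simp: adj_def)
      hence "sup_deg VS e \<le> degree M e" unfolding sup_deg_def degree_def
        by (intro card_mono) (auto simp: adj_def intro: finite_subset[OF _ fin(3)])
      thus "real (sup_deg VS e) \<le> q ^ K" using deg[of e] e by simp
    qed
    \<comment> \<open>The first join rate is \<open>1 / q ^ K\<close>, which cancels the degree
      bound, so each uncovered element contributes at most 1.\<close>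
    hence "rate q K 0 * (\<Sum>e\<in>U. real (sup_deg VS e)) \<le> rate q K 0 * (real (card U) * q ^ K)"
      using rate_pos[of 0] by (intro mult_left_mono) auto
    also have "\<dots> = real (card U)" using q by (simp add: rate_def)
    finally have "rate q K i * (rate q K 0 * (\<Sum>e\<in>U. real (sup_deg VS e))) \<le> rate q K i * real (card U)"
      using rate_pos[of i] by (intro mult_left_mono) auto
    thus "potential (rate q K i) q (rate q K 0) (reset (i * Suc K) x)
      \<le> (case x of (A, J, U) \<Rightarrow> real (card J) + rate q K i * (1 + q) * real (card U))"
      by (simp del: mult_Suc_right add: potential_def reset_first) (simp add: algebra_simps)
  qed
next
  case (Suc m)
  have "measure_pmf.expectation (run (i * Suc K + Suc m))
           (\<lambda>x. potential (rate q K i) q (rate q K (Suc m)) (reset (i * Suc K + Suc m) x))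
     = measure_pmf.expectation (run (Suc (i * Suc K + m))) (potential (rate q K i) q (rate q K (Suc m)))"
    by (simp only: add_Suc_right reset_later[OF Suc.prems])
  also have "\<dots> \<le> measure_pmf.expectation (run (i * Suc K + m))
           (\<lambda>x. potential (rate q K i) q (rate q K m) (reset (i * Suc K + m) x))"
    unfolding run_Suc[OF Suc_leD[OF Suc.prems]]
    using rate_pos rate_le_1 i Suc.prems q
    by (intro expectation_bind_le expectation_trial_potential finite_run finite_trial valid_reset)
       (auto simp: rate_Suc less_imp_le intro: valid_run)
  finally show ?case using Suc by simp
qed

lemma phase_cost:
  assumes i: "i \<le> K"
  shows "measure_pmf.expectation (run (Suc i * Suc K)) (\<lambda>(A, J, U). real (card J))
    \<le> measure_pmf.expectation (run (i * Suc K)) (\<lambda>(A, J, U). real (card J))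
      + (1 + q) * (rate q K i * measure_pmf.expectation (run (i * Suc K)) (\<lambda>(A, J, U). real (card U)))"
proof -
  have int: "integrable (measure_pmf (run n)) g" for n and g :: "_ \<Rightarrow> real"
    by (rule integrable_measure_pmf_finite[OF finite_run])
  have eq: "Suc i * Suc K = Suc (i * Suc K + K)" by simp
  \<comment> \<open>No trial follows trial \<open>K\<close> in the phase, so the next rate may be
    taken as 0. The potential then still dominates \<open>|J|\<close>.\<close>
  have "measure_pmf.expectation (run (Suc i * Suc K)) (\<lambda>(A, J, U). real (card J))
     \<le> measure_pmf.expectation (run (Suc i * Suc K)) (potential (rate q K i) q 0)"
    using rate_pos[of i] q
    by (intro expectation_mono_finite finite_run) (auto simp: potential_def)
  also have "\<dots> \<le> measure_pmf.expectation (run (i * Suc K + K))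
           (\<lambda>x. potential (rate q K i) q (rate q K K) (reset (i * Suc K + K) x))"
    unfolding eq run_Suc[OF order_refl]
    using rate_pos rate_le_1 i q
    by (intro expectation_bind_le expectation_trial_potential finite_run finite_trial valid_reset)
       (auto simp: less_imp_le intro: valid_run)
  also have "\<dots> \<le> measure_pmf.expectation (run (i * Suc K))
         (\<lambda>(A, J, U). real (card J) + rate q K i * (1 + q) * real (card U))"
    by (rule phase_potential[OF i order_refl])
  also have "\<dots> = measure_pmf.expectation (run (i * Suc K)) (\<lambda>(A, J, U). real (card J))
      + (1 + q) * (rate q K i * measure_pmf.expectation (run (i * Suc K)) (\<lambda>(A, J, U). real (card U)))"
    unfolding split_beta by (subst Bochner_Integration.integral_add[OF int int]) (simp add: mult_ac)
  finally show ?thesis .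
qed

section \<open>Residual degrees after one phase\<close>

lemma trial_residual:
  assumes i: "i \<le> K" and m: "m \<le> K" and s: "s \<in> VS"
    and d: "\<And>n. real n * (1 - rate q K i) ^ n \<le> d"
  defines "n \<equiv> i * Suc K + m"
  shows "measure_pmf.expectation (run (Suc n))
           (\<lambda>(A, J, U). of_bool (s \<notin> A \<or> rate q K m = 1) * real (residual U s))
    \<le> measure_pmf.expectation (run n)
           (\<lambda>x. case reset n x of (A, J, U) \<Rightarrow> of_bool (s \<notin> A) * real (residual U s)) + d"
proof -
  have "measure_pmf.expectation (run (Suc n))
           (\<lambda>(A, J, U). of_bool (s \<notin> A \<or> rate q K m = 1) * real (residual U s))
    \<le> measure_pmf.expectation (run n)
           (\<lambda>x. (case reset n x of (A, J, U) \<Rightarrow> of_bool (s \<notin> A) * real (residual U s)) + d)"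
    unfolding n_def run_Suc[OF m]
  proof (rule expectation_bind_le[OF finite_run finite_trial])
    fix x assume "x \<in> set_pmf (run (i * Suc K + m))"
    hence v: "valid (reset (i * Suc K + m) x)" by (intro valid_reset valid_run)
    obtain A J U where [simp]: "reset (i * Suc K + m) x = (A, J, U)" using prod_cases3 .
    show "measure_pmf.expectation (trial (rate q K i) (rate q K m) (reset (i * Suc K + m) x))
           (\<lambda>(A, J, U). of_bool (s \<notin> A \<or> rate q K m = 1) * real (residual U s))
      \<le> (case reset (i * Suc K + m) x of (A, J, U) \<Rightarrow> of_bool (s \<notin> A) * real (residual U s)) + d"
      using expectation_trial_inactive[of A J U "rate q K i" s d "rate q K m"] v s d
        rate_le_1[OF i] rate_pos[of i] by (simp del: mult_Suc_right)
  qed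
  also have "\<dots> = measure_pmf.expectation (run n)
           (\<lambda>x. case reset n x of (A, J, U) \<Rightarrow> of_bool (s \<notin> A) * real (residual U s)) + d"
    by (subst Bochner_Integration.integral_add) (auto intro: integrable_measure_pmf_finite finite_run)
  finally show ?thesis .
qed

text \<open>All sets are active at the start, so the inactive residual begins at 0 and each of the
  \<open>Suc K\<close> trials adds at most \<open>d\<close>. Keeping \<open>d\<close> abstract
  allows \<open>1 / rate q K i\<close> in general and 0 in the last phase.\<close>

lemma phase_residual:
  assumes i: "i \<le> K" and s: "s \<in> VS" and d: "\<And>n. real n * (1 - rate q K i) ^ n \<le> d"
  shows "measure_pmf.expectation (run (Suc i * Suc K)) (\<lambda>(A, J, U). real (residual U s)) \<le> real (Suc K) * d"
proof -
  let ?D = "\<lambda>(A, J, U). of_bool (s \<notin> A) * real (residual U s)"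
  have *: "measure_pmf.expectation (run (i * Suc K + m)) (\<lambda>x. ?D (reset (i * Suc K + m) x)) \<le> real m * d"
    if "m \<le> K" for m
    using that
  proof (induction m)
    case 0
    have "?D (reset (i * Suc K) x) = 0" for x
      using s by (cases x) (simp del: mult_Suc_right add: reset_first)
    thus ?case by (simp del: mult_Suc_right)
  next
    case (Suc m)
    have "measure_pmf.expectation (run (i * Suc K + Suc m)) (\<lambda>x. ?D (reset (i * Suc K + Suc m) x))
       = measure_pmf.expectation (run (Suc (i * Suc K + m))) ?D"
      by (simp only: add_Suc_right reset_later[OF Suc.prems])
    also have "\<dots> \<le> measure_pmf.expectation (run (Suc (i * Suc K + m)))
       (\<lambda>(A, J, U). of_bool (s \<notin> A \<or> rate q K m = 1) * real (residual U s))"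
      by (intro expectation_mono_finite finite_run) auto
    also have "\<dots> \<le> measure_pmf.expectation (run (i * Suc K + m)) (\<lambda>x. ?D (reset (i * Suc K + m) x)) + d"
      by (rule trial_residual[OF i _ s d]) (use Suc.prems in simp)
    finally show ?case using Suc by (simp add: algebra_simps)
  qed
  have eq: "Suc i * Suc K = Suc (i * Suc K + K)" by simp
  \<comment> \<open>Trial \<open>K\<close> has join rate 1, so the indicator is constantly 1 and the
    full residual is bounded.\<close>
  have "measure_pmf.expectation (run (Suc (i * Suc K + K)))
         (\<lambda>(A, J, U). of_bool (s \<notin> A \<or> rate q K K = 1) * real (residual U s)) \<le> real K * d + d"
    using trial_residual[OF i order_refl s d] *[OF order_refl] by linarith
  thus ?thesis unfolding eq by (simp add: rate_K algebra_simps)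
qed

section \<open>From residual degrees to uncovered elements and total cost\<close>

lemma card_uncovered_le:
  assumes "is_cover VS VU M C" "U \<subseteq> VU"
  shows "card U \<le> (\<Sum>s\<in>C. residual U s)"
proof -
  have "finite C" "finite U"
    using assms fin finite_subset by (auto simp: is_cover_def)
  moreover have "U \<subseteq> (\<Union>s\<in>C. {e\<in>U. (s, e) \<in> M})"
    using assms by (auto simp: is_cover_def)
  ultimately have "card U \<le> card (\<Union>s\<in>C. {e\<in>U. (s, e) \<in> M})"
    by (intro card_mono) auto
  also have "\<dots> \<le> (\<Sum>s\<in>C. residual U s)"
    unfolding residual_def by (rule card_UN_le[OF \<open>finite C\<close>])
  finally show ?thesis .
qed

text \<open>The previous phase leaves each set of \<open>C\<close> an expected residual of
  \<open>Suc K / rate q K (i - 1) = Suc K * q / rate q K i\<close> at most; for \<open>i = 0\<close>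
  the degree bound \<open>q ^ K = 1 / rate q K 0\<close> serves instead. Summing over
  \<open>C\<close> bounds the uncovered elements.\<close>

lemma uncovered_bound:
  assumes C: "is_cover VS VU M C" and i: "i \<le> K"
  shows "rate q K i * measure_pmf.expectation (run (i * Suc K)) (\<lambda>(A, J, U). real (card U))
    \<le> real (Suc K) * q * real (card C)"
proof -
  have finC: "finite C" "C \<subseteq> VS" using C fin finite_subset by (auto simp: is_cover_def)
  have res: "measure_pmf.expectation (run (i * Suc K)) (\<lambda>(A, J, U). real (residual U s))
     \<le> real (Suc K) * q / rate q K i" if s: "s \<in> VS" for s
  proof (cases i)
    case 0
    have "{v. adj M v s} \<subseteq> VS \<union> VU" using M_sub by (auto simp: adj_def)
    hence "residual VU s \<le> degree M s" unfolding residual_def degree_def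
      by (intro card_mono) (auto simp: adj_def intro: finite_subset[OF _ fin(3)])
    hence "real (residual VU s) \<le> q ^ K" using deg[of s] s by simp
    also have "1 * 1 * q ^ K \<le> real (Suc K) * q * q ^ K"
      using q by (intro mult_mono) auto
    finally show ?thesis using 0 by (simp add: rate_def)
  next
    case (Suc i')
    have "measure_pmf.expectation (run (i * Suc K)) (\<lambda>(A, J, U). real (residual U s))
       \<le> real (Suc K) * (1 / rate q K i')"
      unfolding Suc using Suc i s rate_pos rate_le_1
      by (intro phase_residual mult_power_le_inverse) auto
    thus ?thesis using q by (simp add: Suc rate_Suc)
  qed
  have "measure_pmf.expectation (run (i * Suc K)) (\<lambda>(A, J, U). real (card U))
     \<le> measure_pmf.expectation (run (i * Suc K)) (\<lambda>x. \<Sum>s\<in>C. case x of (A, J, U) \<Rightarrow> real (residual U s))"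
  proof (rule expectation_mono_finite[OF finite_run])
    fix x assume "x \<in> set_pmf (run (i * Suc K))"
    moreover obtain A J U where [simp]: "x = (A, J, U)" by (cases x)
    ultimately have "U \<subseteq> VU" using valid_run[of x] by (auto simp: valid_def)
    hence "real (card U) \<le> real (\<Sum>s\<in>C. residual U s)"
      using card_uncovered_le[OF C] by (simp only: of_nat_le_iff)
    thus "(case x of (A, J, U) \<Rightarrow> real (card U)) \<le> (\<Sum>s\<in>C. case x of (A, J, U) \<Rightarrow> real (residual U s))"
      by simp
  qed
  also have "\<dots> = (\<Sum>s\<in>C. measure_pmf.expectation (run (i * Suc K)) (\<lambda>(A, J, U). real (residual U s)))"
    by (subst Bochner_Integration.integral_sum) (auto intro: integrable_measure_pmf_finite finite_run)
  also have "\<dots> \<le> (\<Sum>s\<in>C. real (Suc K) * q / rate q K i)"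
    using finC res by (intro sum_mono) auto
  finally show ?thesis using rate_pos[of i] by (simp add: field_simps)
qed

lemma total_cost:
  assumes C: "is_cover VS VU M C" and "i \<le> Suc K"
  shows "measure_pmf.expectation (run (i * Suc K)) (\<lambda>(A, J, U). real (card J))
    \<le> real i * ((1 + q) * (real (Suc K) * q * real (card C)))"
  using assms(2)
proof (induction i)
  case 0
  thus ?case by simp
next
  case (Suc i)
  have "measure_pmf.expectation (run (Suc i * Suc K)) (\<lambda>(A, J, U). real (card J))
    \<le> real i * ((1 + q) * (real (Suc K) * q * real (card C)))
      + (1 + q) * (real (Suc K) * q * real (card C))"
    using Suc q
    by (intro order_trans[OF phase_cost] add_mono mult_left_mono uncovered_bound[OF C]) auto
  thus ?case by (simp add: algebra_simps)
qed

text \<open>In the last phase the test rate is 1, so \<open>real n * 0 ^ n = 0\<close> permits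
  \<open>d = 0\<close>: every residual has mean 0 and hence vanishes on the whole support.\<close>

lemma all_covered:
  assumes C: "is_cover VS VU M C" and x: "(A, J, U) \<in> set_pmf (run (Suc K * Suc K))"
  shows "U = {}"
proof -
  have "residual U s = 0" if s: "s \<in> VS" for s
  proof -
    have "measure_pmf.expectation (run (Suc K * Suc K)) (\<lambda>(A, J, U). real (residual U s)) \<le> real (Suc K) * 0"
      using s by (intro phase_residual) (auto simp: rate_K power_0_left)
    from expectation_nonpos_imp_zero[OF finite_run _ this[unfolded mult_zero_right] x]
    show ?thesis by auto
  qed
  moreover have v: "U \<subseteq> VU" using valid_run[OF x] by (simp add: valid_def)
  moreover have "C \<subseteq> VS" using C by (simp add: is_cover_def)
  ultimately have "card U = 0" using card_uncovered_le[OF C v] by (simp add: subset_iff)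
  moreover have "finite U" using v fin(2) by (rule finite_subset)
  ultimately show ?thesis by simp
qed

end

section \<open>The beeping algorithm\<close>

text \<open>A state records the slot number, whether the node is a set node, whether it is
  active (sets) or uncovered (elements), and whether it has joined the cover. Even slots are tests,
  odd slots are for joining.\<close>

definition encode :: "nat \<Rightarrow> bool \<Rightarrow> bool \<Rightarrow> bool \<Rightarrow> nat list" where
  "encode t r x y = [t, of_bool r, of_bool x, of_bool y]"

definition beep_prob :: "real \<Rightarrow> nat \<Rightarrow> nat list \<Rightarrow> real" where
  "beep_prob q K s = (let n = s ! 0 div 2 in
     if s ! 2 = 1 \<and> (s ! 1 = 1 \<longleftrightarrow> odd (s ! 0))
     then rate q K (if odd (s ! 0) then n mod Suc K else n div Suc K) else 0)"

text \<open>The reset at the start of a phase is folded into the test slot: the disjunct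
  \<open>t div 2 mod Suc K = 0\<close> lets every set take part.\<close>

definition next_state :: "nat \<Rightarrow> nat list \<Rightarrow> bool \<Rightarrow> bool \<Rightarrow> nat list" where
  "next_state K s beep h = (let t = s ! 0; r = (s ! 1 = 1); x = (s ! 2 = 1); y = (s ! 3 = 1) in
     encode (Suc t) r
       (if r then (if even t then (t div 2 mod Suc K = 0 \<or> x) \<and> h else x)
        else x \<and> (odd t \<longrightarrow> \<not> h))
       (y \<or> r \<and> odd t \<and> beep))"

definition beep_step :: "real \<Rightarrow> nat \<Rightarrow> nat list \<Rightarrow> (bool \<times> (bool \<Rightarrow> nat list)) pmf" where
  "beep_step q K s = map_pmf (\<lambda>b. (b, next_state K s b)) (bernoulli_pmf (beep_prob q K s))"

definition start_state :: "bool \<Rightarrow> nat list" where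
  "start_state r = encode 0 r True False"

definition joined :: "nat list \<Rightarrow> bool" where
  "joined s \<longleftrightarrow> s ! 3 = 1"

context schedule
begin

text \<open>Nodes outside the instance keep the state \<open>beep_exec\<close> gives them initially,
  hence the default \<open>start_state False\<close>.\<close>

definition states :: "nat \<Rightarrow> 'v cfg \<Rightarrow> 'v \<Rightarrow> nat list" where
  "states t = (\<lambda>(A, J, U) v.
     if v \<in> VS then encode t True (v \<in> A) (v \<in> J)
     else if v \<in> VU then encode t False (v \<in> U) False
     else start_state False)"

lemma beep_prob_encode:
  "beep_prob q K (encode (2 * n) r x y) = (if x \<and> \<not> r then rate q K (n div Suc K) else 0)"
  "beep_prob q K (encode (Suc (2 * n)) r x y) = (if x \<and> r then rate q K (n mod Suc K) else 0)"
  by (auto simp: beep_prob_def encode_def Let_def)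

lemma next_state_encode:
  "next_state K (encode (2 * n) r x y) b h =
     encode (Suc (2 * n)) r (if r then (n mod Suc K = 0 \<or> x) \<and> h else x) y"
  "next_state K (encode (Suc (2 * n)) r x y) b h =
     encode (Suc (Suc (2 * n))) r (if r then x else x \<and> \<not> h) (y \<or> r \<and> b)"
  by (auto simp: next_state_def encode_def Let_def)

text \<open>The reset changes only \<open>A\<close>, whereas the beepers of a test depend on
  \<open>U\<close>, so resetting within the slot has the same effect as resetting before it.\<close>

lemma beep_round_test:
  assumes "valid x"
  shows "beep_round (VS \<union> VU) M (beep_step q K) (states (2 * n) x)
       = map_pmf (states (Suc (2 * n))) (test_slot (rate q K (n div Suc K)) (reset n x))"
proof -
  obtain A J U where x: "x = (A, J, U)" by (cases x)
  let ?V = "VS \<union> VU"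
  let ?P = "random_subset ?V (\<lambda>v. if v \<in> U then rate q K (n div Suc K) else 0)"
  have sub: "A \<subseteq> VS" "U \<subseteq> VU" using assms by (auto simp: x valid_def)
  have P: "random_subset ?V (\<lambda>v. beep_prob q K (states (2 * n) x v)) = ?P"
    using sub disj by (intro random_subset_cong fin) (auto simp: states_def x beep_prob_encode)
  show ?thesis
    unfolding beep_round_random_subset[OF fin(3) beep_step_def] P
    unfolding x reset_def test_slot_def prod.case map_pmf_comp
  proof (intro map_pmf_cong refl ext)
    fix B v assume "B \<in> set_pmf ?P"
    from in_random_subset[OF fin(3) this] have BU: "B \<subseteq> U" by (force split: if_splits)
    show "(if v \<in> ?V then next_state K (states (2 * n) (A, J, U) v) (v \<in> B) (v \<notin> B \<and> (\<exists>u\<in>B. adj M u v))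
           else states (2 * n) (A, J, U) v)
      = states (Suc (2 * n)) ({s \<in> if n mod Suc K = 0 then VS else A. \<exists>e\<in>B. adj M e s}, J, U) v"
      using sub disj BU by (auto simp: states_def next_state_encode intro!: arg_cong2[where f = "encode _ _"])
  qed
qed

lemma beep_round_join:
  assumes "valid x"
  shows "beep_round (VS \<union> VU) M (beep_step q K) (states (Suc (2 * n)) x)
       = map_pmf (states (Suc (Suc (2 * n)))) (join_slot (rate q K (n mod Suc K)) x)"
proof -
  obtain A J U where x: "x = (A, J, U)" by (cases x)
  let ?V = "VS \<union> VU"
  let ?P = "random_subset ?V (\<lambda>v. if v \<in> A then rate q K (n mod Suc K) else 0)"
  have sub: "A \<subseteq> VS" "U \<subseteq> VU" using assms by (auto simp: x valid_def)
  have P: "random_subset ?V (\<lambda>v. beep_prob q K (states (Suc (2 * n)) x v)) = ?P"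
    using sub disj by (intro random_subset_cong fin) (auto simp: states_def x beep_prob_encode)
  show ?thesis
    unfolding beep_round_random_subset[OF fin(3) beep_step_def] P
    unfolding x join_slot_def prod.case map_pmf_comp
  proof (intro map_pmf_cong refl ext)
    fix B v assume "B \<in> set_pmf ?P"
    from in_random_subset[OF fin(3) this] have BA: "B \<subseteq> A" by (force split: if_splits)
    show "(if v \<in> ?V then next_state K (states (Suc (2 * n)) (A, J, U) v) (v \<in> B) (v \<notin> B \<and> (\<exists>u\<in>B. adj M u v))
           else states (Suc (2 * n)) (A, J, U) v)
      = states (Suc (Suc (2 * n))) (A, J \<union> B, {e\<in>U. \<not> (\<exists>s\<in>B. adj M s e)}) v"
      using sub disj BA by (auto simp: states_def next_state_encode intro!: arg_cong2[where f = "encode _ _"])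
  qed
qed

lemma beep_exec_run:
  "beep_exec VS VU M start_state (beep_step q K) (2 * n) = map_pmf (states (2 * n)) (run n)"
proof (induction n)
  case 0
  have "states 0 (VS, {}, VU) = (\<lambda>v. start_state (v \<in> VS))"
    by (auto simp: states_def start_state_def fun_eq_iff)
  thus ?case by simp
next
  case (Suc n)
  let ?R = "beep_round (VS \<union> VU) M (beep_step q K)"
  let ?b = "rate q K (n div Suc K)" and ?p = "rate q K (n mod Suc K)"
  have "beep_exec VS VU M start_state (beep_step q K) (2 * Suc n)
     = bind_pmf (run n) (\<lambda>x. bind_pmf (?R (states (2 * n) x)) ?R)"
    by (simp add: Suc bind_map_pmf bind_assoc_pmf)
  also have "\<dots> = bind_pmf (run n) (\<lambda>x. map_pmf (states (2 * Suc n)) (trial ?b ?p (reset n x)))"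
  proof (intro bind_pmf_cong refl)
    fix x assume "x \<in> set_pmf (run n)"
    hence v: "valid x" by (rule valid_run)
    have "bind_pmf (?R (states (2 * n) x)) ?R
       = bind_pmf (test_slot ?b (reset n x)) (\<lambda>y. ?R (states (Suc (2 * n)) y))"
      by (simp add: beep_round_test[OF v] bind_map_pmf)
    also have "\<dots> = bind_pmf (test_slot ?b (reset n x))
        (\<lambda>y. map_pmf (states (Suc (Suc (2 * n)))) (join_slot ?p y))"
      by (intro bind_pmf_cong refl beep_round_join) (rule valid_test_slot[OF valid_reset[OF v]])
    finally show "bind_pmf (?R (states (2 * n) x)) ?R
       = map_pmf (states (2 * Suc n)) (trial ?b ?p (reset n x))"
      by (simp add: trial_def map_bind_pmf)
  qed
  finally show ?case by (simp add: map_bind_pmf)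
qed

lemma output_cover_states:
  assumes "valid (A, J, U)"
  shows "output_cover VS joined (states t (A, J, U)) = J"
  using assms by (auto simp: output_cover_def joined_def states_def encode_def valid_def)

lemma algorithm_correct:
  assumes C: "is_cover VS VU M C"
    and c: "c \<in> set_pmf (beep_exec VS VU M start_state (beep_step q K) (2 * (Suc K * Suc K)))"
  shows "is_cover VS VU M (output_cover VS joined c)"
proof -
  obtain y where y: "y \<in> set_pmf (run (Suc K * Suc K))" and c': "c = states (2 * (Suc K * Suc K)) y"
    by (rule imageE[OF c[unfolded beep_exec_run set_map_pmf]])
  obtain A J U where y_eq: "y = (A, J, U)" by (rule prod_cases3)
  note x = y[unfolded y_eq]
  show ?thesis
    unfolding c' y_eq output_cover_states[OF valid_run[OF x]]
    using valid_run[OF x] all_covered[OF C x] by (simp add: is_cover_def valid_def)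
qed

lemma algorithm_cost:
  assumes C: "is_cover VS VU M C"
  shows "measure_pmf.expectation
      (beep_exec VS VU M start_state (beep_step q K) (2 * (Suc K * Suc K)))
      (\<lambda>c. real (card (output_cover VS joined c)))
    \<le> (real (Suc K))\<^sup>2 * (q * (1 + q)) * real (card C)"
proof -
  have "measure_pmf.expectation
      (beep_exec VS VU M start_state (beep_step q K) (2 * (Suc K * Suc K)))
      (\<lambda>c. real (card (output_cover VS joined c)))
    \<le> measure_pmf.expectation (run (Suc K * Suc K)) (\<lambda>(A, J, U). real (card J))"
    unfolding beep_exec_run integral_map_pmf
  proof (rule expectation_mono_finite[OF finite_run])
    fix y assume y: "y \<in> set_pmf (run (Suc K * Suc K))"
    obtain A J U where y_eq: "y = (A, J, U)" by (rule prod_cases3)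
    show "real (card (output_cover VS joined (states (2 * (Suc K * Suc K)) y)))
        \<le> (case y of (A, J, U) \<Rightarrow> real (card J))"
      unfolding y_eq output_cover_states[OF valid_run[OF y[unfolded y_eq]]] by simp
  qed
  also have "\<dots> \<le> real (Suc K) * ((1 + q) * (real (Suc K) * q * real (card C)))"
    by (rule total_cost[OF C order_refl])
  \<comment> \<open>One factor \<open>Suc K\<close> counts the phases, the other the trials that add
    to a residual.\<close>
  also have "\<dots> = (real (Suc K))\<^sup>2 * (q * (1 + q)) * real (card C)"
    by (simp add: power2_eq_square mult_ac)
  finally show ?thesis .
qed

end

section \<open>The optimum and the choice of parameters\<close>

lemma opt_cover_attained:
  assumes wf: "wf_instance VS VU M" and ex: "\<forall>e\<in>VU. \<exists>s\<in>VS. (s, e) \<in> M"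
  obtains C where "is_cover VS VU M C" "card C = opt_cover VS VU M"
proof -
  have "finite VS" using wf by (simp add: wf_instance_def)
  hence "finite {C. is_cover VS VU M C}"
    by (auto simp: is_cover_def intro: rev_finite_subset[of "Pow VS"])
  moreover have "VS \<in> {C. is_cover VS VU M C}" using ex by (simp add: is_cover_def)
  ultimately have "Min (card ` {C. is_cover VS VU M C}) \<in> card ` {C. is_cover VS VU M C}"
    by (intro Min_in) auto
  thus ?thesis using that by (auto simp: opt_cover_def)
qed

text \<open>The bound has a factor \<open>(K + 1)\<^sup>2\<close>, so \<open>k\<close> is capped at \<open>ln \<Delta>\<close>; at the cap the growth factor
  \<open>\<Delta> powr (1 / K)\<close> is still at most \<open>exp 1\<close>.\<close>

lemma growth_factor:
  fixes \<Delta> k :: nat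
  assumes k: "k > 3" and D: "\<Delta> \<ge> 2"
  obtains K :: nat and q :: real
  where "K \<le> k" "1 \<le> q" "q ^ K = real \<Delta>" "real (Suc K) \<le> 4 * ln (real \<Delta>)"
    "q \<le> 3 * real \<Delta> powr (1 / real k)"
proof -
  define L where "L = nat \<lceil>ln (real \<Delta>)\<rceil>"
  define K where "K = min k L"
  define q where "q = real \<Delta> powr (1 / real K)"
  have "ln 2 \<le> ln (real \<Delta>)" using D by simp
  hence ln: "2 / 3 \<le> ln (real \<Delta>)" using ln2_ge_two_thirds by linarith
  have L: "real L \<le> ln (real \<Delta>) + 1" "ln (real \<Delta>) \<le> real L" "L > 0"
    using ln unfolding L_def by linarith+
  have K0: "K > 0" using k L by (simp add: K_def)
  have pow: "1 \<le> real \<Delta> powr (1 / real k)" using D by (simp add: ge_one_powr_ge_zero)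
  have "q ^ K = real \<Delta>"
    using K0 D by (simp add: q_def powr_power)
  moreover have "1 \<le> q" using D by (simp add: q_def ge_one_powr_ge_zero)
  \<comment> \<open>\<open>Suc K\<close> is at most \<open>ln (real \<Delta>) + 2\<close>, and the
    lower bound 2/3 on the logarithm absorbs the 2.\<close>
  moreover have "real (Suc K) \<le> 4 * ln (real \<Delta>)"
    using L ln by (simp add: K_def min_def split: if_splits)
  moreover have "q \<le> 3 * real \<Delta> powr (1 / real k)"
  proof (cases "k \<le> L")
    case True
    thus ?thesis using pow by (simp add: q_def K_def min_def)
  next
    case False
    hence "q = exp (ln (real \<Delta>) / real L)"
      using D by (simp add: q_def K_def min_def powr_def)
    also have "\<dots> \<le> exp 1" using L by (simp add: field_simps)
    also have "\<dots> \<le> 3" by (rule exp_le)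
    finally show ?thesis using pow by linarith
  qed
  ultimately show ?thesis using that[of K q] by (simp add: K_def)
qed

theorem theorem1:
  "\<exists>C1 C2 :: real. C1 > 0 \<and> C2 > 0 \<and>
    (\<forall>(k::nat) > 3. \<forall>(\<Delta>::nat) \<ge> 2.
      \<exists>(init :: bool \<Rightarrow> nat list) (step :: nat list \<Rightarrow> (bool \<times> (bool \<Rightarrow> nat list)) pmf)
        (out :: nat list \<Rightarrow> bool) (T :: nat).
        real T \<le> C1 * real k ^ 3 \<and>
        (\<forall>(VS :: 'v set) VU M.
           wf_instance VS VU M \<longrightarrow> (\<forall>e\<in>VU. \<exists>s\<in>VS. (s, e) \<in> M) \<longrightarrow>
           max_degree VS VU M = \<Delta> \<longrightarrow>
             (\<forall>c \<in> set_pmf (beep_exec VS VU M init step T).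
                is_cover VS VU M (output_cover VS out c)) \<and>
             measure_pmf.expectation (beep_exec VS VU M init step T)
                 (\<lambda>c. real (card (output_cover VS out c)))
               \<le> C2 * (ln (real \<Delta>))\<^sup>2 * (real \<Delta> powr (1 / real k)) ^ 3
                   * real (opt_cover VS VU M)))"
proof (rule exI[of _ 2], rule exI[of _ 288], intro conjI allI impI)
  \<comment> \<open>The constant 288 is \<open>16 * 18\<close>: 16 from squaring
    \<open>4 * ln (real \<Delta>)\<close>, and 18 from \<open>q \<le> 3 * r\<close> and
    \<open>1 + q \<le> 6 * r\<close>.\<close>
  fix k \<Delta> :: nat
  assume k: "k > 3" and D: "\<Delta> \<ge> 2"
  obtain K q where K: "K \<le> k" and q: "1 \<le> q" "q ^ K = real \<Delta>"
    and Kln: "real (Suc K) \<le> 4 * ln (real \<Delta>)" and qD: "q \<le> 3 * real \<Delta> powr (1 / real k)"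
    using growth_factor[OF k D] by metis
  define r where "r = real \<Delta> powr (1 / real k)"
  have r1: "1 \<le> r" using D by (simp add: r_def ge_one_powr_ge_zero)
  let ?T = "2 * (Suc K * Suc K)"
  have "Suc K * Suc K \<le> (2 * k) * (2 * k)" using K k by (intro mult_le_mono) auto
  also have "(2 * k) * (2 * k) = 4 * (k * k)" by simp
  \<comment> \<open>Here \<open>k > 3\<close> absorbs the factor 4, so the slot count, quadratic in
    \<open>K\<close>, stays within the cubic bound.\<close>
  also have "4 * (k * k) \<le> k * (k * k)" using k by (intro mult_le_mono1) simp
  finally have "real (Suc K * Suc K) \<le> real (k * (k * k))" by (simp only: of_nat_le_iff)
  also have "\<dots> = real k ^ 3" by (simp add: power3_eq_cube)
  finally have T: "real ?T \<le> 2 * real k ^ 3" by (simp only: of_nat_mult of_nat_numeral)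
  have "q * (1 + q) \<le> (3 * r) * (6 * r)"
    using q qD r1 by (intro mult_mono) (auto simp: r_def)
  also have "\<dots> = 18 * r ^ 2" by (simp add: power2_eq_square)
  also have "\<dots> \<le> 18 * r ^ 3" using r1 by (intro mult_left_mono power_increasing) auto
  finally have qr: "q * (1 + q) \<le> 18 * r ^ 3" .
  have "(real (Suc K))\<^sup>2 \<le> (4 * ln (real \<Delta>))\<^sup>2" using Kln by (intro power_mono) auto
  hence "(real (Suc K))\<^sup>2 * (q * (1 + q)) \<le> (4 * ln (real \<Delta>))\<^sup>2 * (18 * r ^ 3)"
    by (rule mult_mono) (use qr q in simp_all)
  hence ratio: "(real (Suc K))\<^sup>2 * (q * (1 + q)) \<le> 288 * (ln (real \<Delta>))\<^sup>2 * r ^ 3"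
    by (simp add: power_mult_distrib)
  \<comment> \<open>The witnesses \<open>start_state\<close>, \<open>beep_step q K\<close>,
    \<open>joined\<close> and \<open>?T\<close> depend only on \<open>k\<close> and
    \<open>\<Delta>\<close>; the instance is fixed after them.\<close>
  have main: "(\<forall>c \<in> set_pmf (beep_exec VS VU M start_state (beep_step q K) ?T).
                is_cover VS VU M (output_cover VS joined c)) \<and>
             measure_pmf.expectation (beep_exec VS VU M start_state (beep_step q K) ?T)
                 (\<lambda>c. real (card (output_cover VS joined c)))
               \<le> 288 * (ln (real \<Delta>))\<^sup>2 * r ^ 3 * real (opt_cover VS VU M)"
    if wf: "wf_instance VS VU M" and ex: "\<forall>e\<in>VU. \<exists>s\<in>VS. (s, e) \<in> M"
      and md: "max_degree VS VU M = \<Delta>" for VS VU :: "'v set" and M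
  proof -
    have "degree M v \<le> \<Delta>" if "v \<in> VS \<union> VU" for v
      unfolding md[symmetric] max_degree_def
      using wf that by (intro Max_ge) (auto simp: wf_instance_def)
    then interpret schedule VS VU M K q
      using wf q by unfold_locales auto
    obtain C where C: "is_cover VS VU M C" "card C = opt_cover VS VU M"
      using opt_cover_attained[OF wf ex] .
    have "measure_pmf.expectation (beep_exec VS VU M start_state (beep_step q K) ?T)
                 (\<lambda>c. real (card (output_cover VS joined c)))
        \<le> 288 * (ln (real \<Delta>))\<^sup>2 * r ^ 3 * real (card C)"
      by (rule order_trans[OF algorithm_cost[OF C(1)] mult_right_mono[OF ratio]]) simp
    thus ?thesis using algorithm_correct[OF C(1)] unfolding C(2) by blast
  qed
  show "\<exists>(init :: bool \<Rightarrow> nat list) (step :: nat list \<Rightarrow> (bool \<times> (bool \<Rightarrow> nat list)) pmf)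
        (out :: nat list \<Rightarrow> bool) (T :: nat).
        real T \<le> 2 * real k ^ 3 \<and>
        (\<forall>(VS :: 'v set) VU M.
           wf_instance VS VU M \<longrightarrow> (\<forall>e\<in>VU. \<exists>s\<in>VS. (s, e) \<in> M) \<longrightarrow>
           max_degree VS VU M = \<Delta> \<longrightarrow>
             (\<forall>c \<in> set_pmf (beep_exec VS VU M init step T).
                is_cover VS VU M (output_cover VS out c)) \<and>
             measure_pmf.expectation (beep_exec VS VU M init step T)
                 (\<lambda>c. real (card (output_cover VS out c)))
               \<le> 288 * (ln (real \<Delta>))\<^sup>2 * (real \<Delta> powr (1 / real k)) ^ 3
                   * real (opt_cover VS VU M))"
    by (rule exI[of _ start_state], rule exI[of _ "beep_step q K"], rule exI[of _ joined],
        rule exI[of _ ?T], rule conjI[OF T], intro allI impI, rule main[unfolded r_def])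
qed simp_all

end
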